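(* Let $M$ be a $5\times 5$ dissimilarity matrix. The following are equivalent: (1) $M$ has tree rank at most $2$; (2) the deficiency graph of $M$ is $2$-colorable; (3) the tropical polynomial $P$ attains its minimum at $M$ at a triangle term.
   Context: A $5\times5$ dissimilarity matrix is a function from 2-element subsets of $[5]$ to $\mathbb{R}$. A tree matrix is a dissimilarity matrix $D$ such that for all distinct $i,j,k,l$ the minimum of $D_{ij}+D_{kl}$, $D_{ik}+D_{jl}$, $D_{il}+D_{jk}$ is attained at least twice; the tree rank of $M$ is the least $r$ such that $M$ is the entrywise minimum of $r$ tree matrices. The deficiency graph of $M$ has vertex set the 2-element subsets of $[5]$, with an edge between $\{i,j\}$ and $\{k,l\}$ ($i,j,k,l$ distinct) whenever $M_{ij}+M_{kl}$ is strictly less than both $M_{ik}+M_{jl}$ and $M_{il}+M_{jk}$ (arising from the Plücker relations $x_{ij}x_{kl}\oplus x_{ik}x_{jl}\oplus x_{il}x_{jk}$). $P$ is the tropical sum (minimum) of the 22 tropical monomials of degree 5 in variables $x_{ij}$ ($1\le i<j\le5$) in which each index in $[5]$ appears exactly twice among the subscripts: 12 "pentagons" $x_{b_1b_2}x_{b_2b_3}x_{b_3b_4}x_{b_4b_5}x_{b_5b_1}$ (one per 5-cycle) and 10 "triangles" $x_{ab}x_{bc}x_{ca}x_{de}^2$ with $\{a,b,c,d,e\}=[5]$; a monomial evaluated at $M$ is the corresponding sum of entries of $M$ with multiplicity. *)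

theory Defs
  imports Complex_Main "HOL-Library.Multiset" "HOL-Library.Extended_Nat"
begin

definition pairs :: "nat set set" where
  "pairs = {e. e \<subseteq> {1..5} \<and> card e = 2}"

text \<open>
  A dissimilarity matrix is a function on the 2-element subsets of \<open>{1..5}\<close>. It is represented by
  a total function on sets of naturals; only its values on \<^const>\<open>pairs\<close> are ever used.
\<close>

type_synonym dissim = "nat set \<Rightarrow> real"

definition min_attained_twice :: "real \<Rightarrow> real \<Rightarrow> real \<Rightarrow> bool" where
  "min_attained_twice a b c \<longleftrightarrow>
     (let m = min a (min b c) in (a = m \<and> b = m) \<or> (a = m \<and> c = m) \<or> (b = m \<and> c = m))"

definition tree_matrix :: "dissim \<Rightarrow> bool" where
  "tree_matrix D \<longleftrightarrow>
     (\<forall>i j k l. {i, j, k, l} \<subseteq> {1..5} \<and> distinct [i, j, k, l] \<longrightarrow>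
        min_attained_twice (D {i, j} + D {k, l}) (D {i, k} + D {j, l}) (D {i, l} + D {j, k}))"

text \<open>
  The empty tropical sum is infinite and hence is not a dissimilarity matrix, so \<open>r > 0\<close> is
  required (\<^const>\<open>Min\<close> of the empty set is unspecified).
\<close>

definition min_of_trees :: "dissim \<Rightarrow> nat \<Rightarrow> bool" where
  "min_of_trees M r \<longleftrightarrow> r > 0 \<and>
     (\<exists>T :: nat \<Rightarrow> dissim. (\<forall>s<r. tree_matrix (T s)) \<and>
        (\<forall>e\<in>pairs. M e = Min ((\<lambda>s. T s e) ` {..<r})))"

text \<open>The least such \<open>r\<close>, taken in \<^typ>\<open>enat\<close> so that it would be infinite if no \<open>r\<close> existed.\<close>

definition tree_rank :: "dissim \<Rightarrow> enat" where
  "tree_rank M = (INF r\<in>{r. min_of_trees M r}. enat r)"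

text \<open>The edge set of the deficiency graph, whose vertex set is \<^const>\<open>pairs\<close>.\<close>

definition deficiency_edges :: "dissim \<Rightarrow> nat set set set" where
  "deficiency_edges M =
     {{{i, j}, {k, l}} | i j k l.
        {i, j, k, l} \<subseteq> {1..5} \<and> distinct [i, j, k, l] \<and>
        M {i, j} + M {k, l} < M {i, k} + M {j, l} \<and>
        M {i, j} + M {k, l} < M {i, l} + M {j, k}}"

definition colorable :: "nat \<Rightarrow> 'a set \<Rightarrow> 'a set set \<Rightarrow> bool" where
  "colorable n V E \<longleftrightarrow>
     (\<exists>c :: 'a \<Rightarrow> nat. (\<forall>v\<in>V. c v < n) \<and> (\<forall>u\<in>V. \<forall>v\<in>V. {u, v} \<in> E \<longrightarrow> c u \<noteq> c v))"

text \<open>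
  A tropical monomial in the variables \<open>x\<^sub>i\<^sub>j\<close> is the multiset of the pairs \<open>{i, j}\<close> indexing its
  factors; its degree is the size of the multiset. The number of times an index \<open>i\<close> occurs among
  the subscripts is the number of factors, with multiplicity, whose pair contains \<open>i\<close>.
\<close>

type_synonym monomial = "nat set multiset"

definition eval_monomial :: "dissim \<Rightarrow> monomial \<Rightarrow> real" where
  "eval_monomial M m = (\<Sum>e\<in>#m. M e)"

definition P_monomials :: "monomial set" where
  "P_monomials =
     {m. set_mset m \<subseteq> pairs \<and> size m = 5 \<and> (\<forall>i\<in>{1..5}. size {#e \<in># m. i \<in> e#} = 2)}"

definition pentagon_monomials :: "monomial set" where
  "pentagon_monomials =
     {{#{b1, b2}, {b2, b3}, {b3, b4}, {b4, b5}, {b5, b1}#} | b1 b2 b3 b4 b5.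
        distinct [b1, b2, b3, b4, b5] \<and> {b1, b2, b3, b4, b5} = {1..5}}"

definition triangle_monomials :: "monomial set" where
  "triangle_monomials =
     {{#{a, b}, {b, c}, {c, a}, {d, e}, {d, e}#} | a b c d e.
        distinct [a, b, c, d, e] \<and> {a, b, c, d, e} = {1..5}}"

definition trop_P :: "dissim \<Rightarrow> real" where
  "trop_P M = Min (eval_monomial M ` P_monomials)"

text \<open>
  The remaining facts confirm that \<^const>\<open>P_monomials\<close> consists of exactly the pentagons and the
  triangles, and is finite, so that the \<^const>\<open>Min\<close> in \<^const>\<open>trop_P\<close> is a genuine minimum.
\<close>

lemma pairs_eq: "pairs = {{1,2},{1,3},{1,4},{1,5},{2,3},{2,4},{2,5},{3,4},{3,5},{4,5}}"
    (is "_ = ?R")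
proof
  have v: "{1..5::nat} = {1,2,3,4,5}" by auto
  show "pairs \<subseteq> ?R"
  proof
    fix e assume "e \<in> pairs"
    then obtain x y where e: "e = {x, y}" "x \<noteq> y" and "x \<in> {1..5}" "y \<in> {1..5}"
      unfolding pairs_def card_2_iff by blast
    then have x: "x \<in> {1,2,3,4,5}" and y: "y \<in> {1,2,3,4,5}" unfolding v by simp_all
    show "e \<in> ?R"
      using x y e by (elim insertE emptyE) (simp_all add: insert_commute)
  qed
  show "?R \<subseteq> pairs" by (simp add: pairs_def)
qed

lemma mset_rep: assumes "set_mset m \<subseteq> A" "finite A"
  shows "m = (\<Sum>e\<in>A. replicate_mset (count m e) e)"
proof (rule multiset_eqI)
  fix x
  have "count (\<Sum>e\<in>A. replicate_mset (count m e) e) x = (\<Sum>e\<in>A. if x = e then count m e else 0)"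
    by (simp add: count_sum)
  also have "\<dots> = count m x" using assms by (auto simp: not_in_iff[symmetric] count_eq_zero_iff sum.delta)
  finally show "count m x = count (\<Sum>e\<in>A. replicate_mset (count m e) e) x" by simp
qed

lemma size_filter_rep: assumes "set_mset m \<subseteq> A" "finite A"
  shows "size (filter_mset Q m) = (\<Sum>e\<in>A. if Q e then count m e else 0)"
  apply (subst size_multiset_overloaded_eq)
  apply (rule sum.mono_neutral_cong_left)
  using assms by (auto simp: count_eq_zero_iff)

lemma pentagon_in_P:
  assumes d: "distinct [b1, b2, b3, b4, b5]" and v: "{b1, b2, b3, b4, b5} = {1..5::nat}"
  shows "{#{b1, b2}, {b2, b3}, {b3, b4}, {b4, b5}, {b5, b1}#} \<in> P_monomials"
proof -
  have d': "distinct (rev [b1, b2, b3, b4, b5])" using d by (simp only: distinct_rev)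
  have mem: "b1 \<in> {1..5}" "b2 \<in> {1..5}" "b3 \<in> {1..5}" "b4 \<in> {1..5}" "b5 \<in> {1..5}"
    unfolding v[symmetric] by simp_all
  have neq: "x \<noteq> y \<Longrightarrow> x \<in> {1..5} \<Longrightarrow> y \<in> {1..5} \<Longrightarrow> {x, y} \<in> pairs" for x y
    by (simp add: pairs_def)
  have sub: "set_mset {#{b1, b2}, {b2, b3}, {b3, b4}, {b4, b5}, {b5, b1}#} \<subseteq> pairs"
    using mem d d' by (simp del: atLeastAtMost_iff) (intro conjI neq; (blast | simp))
  have deg: "size {#e \<in># {#{b1, b2}, {b2, b3}, {b3, b4}, {b4, b5}, {b5, b1}#}. i \<in> e#} = 2" if "i \<in> {1..5}" for i
  proof -
    have "i \<in> {b1, b2, b3, b4, b5}" using that v by simp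
    then show ?thesis using d d' by (elim insertE emptyE) simp_all
  qed
  show ?thesis
    unfolding P_monomials_def by (intro CollectI conjI ballI sub deg) simp_all
qed

lemma triangle_in_P:
  assumes d: "distinct [a, b, c, d, e]" and v: "{a, b, c, d, e} = {1..5::nat}"
  shows "{#{a, b}, {b, c}, {c, a}, {d, e}, {d, e}#} \<in> P_monomials"
proof -
  have d': "distinct (rev [a, b, c, d, e])" using d by (simp only: distinct_rev)
  have mem: "a \<in> {1..5}" "b \<in> {1..5}" "c \<in> {1..5}" "d \<in> {1..5}" "e \<in> {1..5}"
    unfolding v[symmetric] by simp_all
  have neq: "x \<noteq> y \<Longrightarrow> x \<in> {1..5} \<Longrightarrow> y \<in> {1..5} \<Longrightarrow> {x, y} \<in> pairs" for x y
    by (simp add: pairs_def)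
  have sub: "set_mset {#{a, b}, {b, c}, {c, a}, {d, e}, {d, e}#} \<subseteq> pairs"
    using mem d d' by (simp del: atLeastAtMost_iff) (intro conjI neq; (blast | simp))
  have deg: "size {#p \<in># {#{a, b}, {b, c}, {c, a}, {d, e}, {d, e}#}. i \<in> p#} = 2" if "i \<in> {1..5}" for i
  proof -
    have "i \<in> {a, b, c, d, e}" using that v by simp
    then show ?thesis using d d' by (elim insertE emptyE) simp_all
  qed
  show ?thesis
    unfolding P_monomials_def by (intro CollectI conjI ballI sub deg) simp_all
qed

lemma pent_tri_sub: "pentagon_monomials \<union> triangle_monomials \<subseteq> P_monomials"
  unfolding pentagon_monomials_def triangle_monomials_def
  by (intro subsetI, elim UnE CollectE exE conjE, simp_all only: pentagon_in_P triangle_in_P)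

lemma deg_cases_aux:
  "\<forall>x12\<in>set [0,1,2::nat]. \<forall>x13\<in>set [0,1,2]. x12 + x13 \<le> 2 \<longrightarrow>
    (\<forall>x14\<in>set [0,1,2]. x12 + x13 + x14 \<le> 2 \<longrightarrow> (\<forall>x23\<in>set [0,1,2]. x12 + x23 \<le> 2 \<and> x13 + x23 \<le> 2 \<longrightarrow>
    (\<forall>x24\<in>set [0,1,2]. x12 + x23 + x24 \<le> 2 \<and> x14 + x24 \<le> 2 \<longrightarrow>
    (\<forall>x34\<in>set [0,1,2]. x13 + x23 + x34 \<le> 2 \<and> x14 + x24 + x34 \<le> 2 \<longrightarrow>
      (2-x12-x13-x14) + (2-x12-x23-x24) + (2-x13-x23-x34) + (2-x14-x24-x34) = 2 \<longrightarrow> ((x12 = 1 \<and> x13 = 0 \<and> x14 = 0 \<and> (2-x12-x13-x14) = 1 \<and> x23 = 1 \<and> x24 = 0 \<and> (2-x12-x23-x24) = 0 \<and> x34 = 1 \<and> (2-x13-x23-x34) = 0 \<and> (2-x14-x24-x34) = 1) \<or>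
    (x12 = 1 \<and> x13 = 0 \<and> x14 = 1 \<and> (2-x12-x13-x14) = 0 \<and> x23 = 1 \<and> x24 = 0 \<and> (2-x12-x23-x24) = 0 \<and> x34 = 0 \<and> (2-x13-x23-x34) = 1 \<and> (2-x14-x24-x34) = 1) \<or>
    (x12 = 1 \<and> x13 = 0 \<and> x14 = 0 \<and> (2-x12-x13-x14) = 1 \<and> x23 = 0 \<and> x24 = 1 \<and> (2-x12-x23-x24) = 0 \<and> x34 = 1 \<and> (2-x13-x23-x34) = 1 \<and> (2-x14-x24-x34) = 0) \<or>
    (x12 = 1 \<and> x13 = 1 \<and> x14 = 0 \<and> (2-x12-x13-x14) = 0 \<and> x23 = 0 \<and> x24 = 1 \<and> (2-x12-x23-x24) = 0 \<and> x34 = 0 \<and> (2-x13-x23-x34) = 1 \<and> (2-x14-x24-x34) = 1) \<or>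
    (x12 = 1 \<and> x13 = 0 \<and> x14 = 1 \<and> (2-x12-x13-x14) = 0 \<and> x23 = 0 \<and> x24 = 0 \<and> (2-x12-x23-x24) = 1 \<and> x34 = 1 \<and> (2-x13-x23-x34) = 1 \<and> (2-x14-x24-x34) = 0) \<or>
    (x12 = 1 \<and> x13 = 1 \<and> x14 = 0 \<and> (2-x12-x13-x14) = 0 \<and> x23 = 0 \<and> x24 = 0 \<and> (2-x12-x23-x24) = 1 \<and> x34 = 1 \<and> (2-x13-x23-x34) = 0 \<and> (2-x14-x24-x34) = 1) \<or>
    (x12 = 0 \<and> x13 = 1 \<and> x14 = 0 \<and> (2-x12-x13-x14) = 1 \<and> x23 = 1 \<and> x24 = 1 \<and> (2-x12-x23-x24) = 0 \<and> x34 = 0 \<and> (2-x13-x23-x34) = 0 \<and> (2-x14-x24-x34) = 1) \<or>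
    (x12 = 0 \<and> x13 = 1 \<and> x14 = 1 \<and> (2-x12-x13-x14) = 0 \<and> x23 = 1 \<and> x24 = 0 \<and> (2-x12-x23-x24) = 1 \<and> x34 = 0 \<and> (2-x13-x23-x34) = 0 \<and> (2-x14-x24-x34) = 1) \<or>
    (x12 = 0 \<and> x13 = 1 \<and> x14 = 0 \<and> (2-x12-x13-x14) = 1 \<and> x23 = 0 \<and> x24 = 1 \<and> (2-x12-x23-x24) = 1 \<and> x34 = 1 \<and> (2-x13-x23-x34) = 0 \<and> (2-x14-x24-x34) = 0) \<or>
    (x12 = 0 \<and> x13 = 1 \<and> x14 = 1 \<and> (2-x12-x13-x14) = 0 \<and> x23 = 0 \<and> x24 = 1 \<and> (2-x12-x23-x24) = 1 \<and> x34 = 0 \<and> (2-x13-x23-x34) = 1 \<and> (2-x14-x24-x34) = 0) \<or>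
    (x12 = 0 \<and> x13 = 0 \<and> x14 = 1 \<and> (2-x12-x13-x14) = 1 \<and> x23 = 1 \<and> x24 = 1 \<and> (2-x12-x23-x24) = 0 \<and> x34 = 0 \<and> (2-x13-x23-x34) = 1 \<and> (2-x14-x24-x34) = 0) \<or>
    (x12 = 0 \<and> x13 = 0 \<and> x14 = 1 \<and> (2-x12-x13-x14) = 1 \<and> x23 = 1 \<and> x24 = 0 \<and> (2-x12-x23-x24) = 1 \<and> x34 = 1 \<and> (2-x13-x23-x34) = 0 \<and> (2-x14-x24-x34) = 0) \<or>
    (x12 = 1 \<and> x13 = 1 \<and> x14 = 0 \<and> (2-x12-x13-x14) = 0 \<and> x23 = 1 \<and> x24 = 0 \<and> (2-x12-x23-x24) = 0 \<and> x34 = 0 \<and> (2-x13-x23-x34) = 0 \<and> (2-x14-x24-x34) = 2) \<or>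
    (x12 = 1 \<and> x13 = 0 \<and> x14 = 1 \<and> (2-x12-x13-x14) = 0 \<and> x23 = 0 \<and> x24 = 1 \<and> (2-x12-x23-x24) = 0 \<and> x34 = 0 \<and> (2-x13-x23-x34) = 2 \<and> (2-x14-x24-x34) = 0) \<or>
    (x12 = 1 \<and> x13 = 0 \<and> x14 = 0 \<and> (2-x12-x13-x14) = 1 \<and> x23 = 0 \<and> x24 = 0 \<and> (2-x12-x23-x24) = 1 \<and> x34 = 2 \<and> (2-x13-x23-x34) = 0 \<and> (2-x14-x24-x34) = 0) \<or>
    (x12 = 0 \<and> x13 = 1 \<and> x14 = 1 \<and> (2-x12-x13-x14) = 0 \<and> x23 = 0 \<and> x24 = 0 \<and> (2-x12-x23-x24) = 2 \<and> x34 = 1 \<and> (2-x13-x23-x34) = 0 \<and> (2-x14-x24-x34) = 0) \<or>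
    (x12 = 0 \<and> x13 = 1 \<and> x14 = 0 \<and> (2-x12-x13-x14) = 1 \<and> x23 = 0 \<and> x24 = 2 \<and> (2-x12-x23-x24) = 0 \<and> x34 = 0 \<and> (2-x13-x23-x34) = 1 \<and> (2-x14-x24-x34) = 0) \<or>
    (x12 = 0 \<and> x13 = 0 \<and> x14 = 1 \<and> (2-x12-x13-x14) = 1 \<and> x23 = 2 \<and> x24 = 0 \<and> (2-x12-x23-x24) = 0 \<and> x34 = 0 \<and> (2-x13-x23-x34) = 0 \<and> (2-x14-x24-x34) = 1) \<or>
    (x12 = 0 \<and> x13 = 0 \<and> x14 = 0 \<and> (2-x12-x13-x14) = 2 \<and> x23 = 1 \<and> x24 = 1 \<and> (2-x12-x23-x24) = 0 \<and> x34 = 1 \<and> (2-x13-x23-x34) = 0 \<and> (2-x14-x24-x34) = 0) \<or>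
    (x12 = 0 \<and> x13 = 0 \<and> x14 = 2 \<and> (2-x12-x13-x14) = 0 \<and> x23 = 1 \<and> x24 = 0 \<and> (2-x12-x23-x24) = 1 \<and> x34 = 0 \<and> (2-x13-x23-x34) = 1 \<and> (2-x14-x24-x34) = 0) \<or>
    (x12 = 0 \<and> x13 = 2 \<and> x14 = 0 \<and> (2-x12-x13-x14) = 0 \<and> x23 = 0 \<and> x24 = 1 \<and> (2-x12-x23-x24) = 1 \<and> x34 = 0 \<and> (2-x13-x23-x34) = 0 \<and> (2-x14-x24-x34) = 1) \<or>
    (x12 = 2 \<and> x13 = 0 \<and> x14 = 0 \<and> (2-x12-x13-x14) = 0 \<and> x23 = 0 \<and> x24 = 0 \<and> (2-x12-x23-x24) = 0 \<and> x34 = 1 \<and> (2-x13-x23-x34) = 1 \<and> (2-x14-x24-x34) = 1))))))"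
  by code_simp

lemma deg_cases:
  fixes x12 x13 x14 x15 x23 x24 x25 x34 x35 x45 :: nat
  assumes "x12 + x13 + x14 + x15 = 2" "x12 + x23 + x24 + x25 = 2" "x13 + x23 + x34 + x35 = 2" "x14 + x24 + x34 + x45 = 2" "x15 + x25 + x35 + x45 = 2"
  shows "(x12 = 1 \<and> x13 = 0 \<and> x14 = 0 \<and> x15 = 1 \<and> x23 = 1 \<and> x24 = 0 \<and> x25 = 0 \<and> x34 = 1 \<and> x35 = 0 \<and> x45 = 1) \<or>
    (x12 = 1 \<and> x13 = 0 \<and> x14 = 1 \<and> x15 = 0 \<and> x23 = 1 \<and> x24 = 0 \<and> x25 = 0 \<and> x34 = 0 \<and> x35 = 1 \<and> x45 = 1) \<or>
    (x12 = 1 \<and> x13 = 0 \<and> x14 = 0 \<and> x15 = 1 \<and> x23 = 0 \<and> x24 = 1 \<and> x25 = 0 \<and> x34 = 1 \<and> x35 = 1 \<and> x45 = 0) \<or>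
    (x12 = 1 \<and> x13 = 1 \<and> x14 = 0 \<and> x15 = 0 \<and> x23 = 0 \<and> x24 = 1 \<and> x25 = 0 \<and> x34 = 0 \<and> x35 = 1 \<and> x45 = 1) \<or>
    (x12 = 1 \<and> x13 = 0 \<and> x14 = 1 \<and> x15 = 0 \<and> x23 = 0 \<and> x24 = 0 \<and> x25 = 1 \<and> x34 = 1 \<and> x35 = 1 \<and> x45 = 0) \<or>
    (x12 = 1 \<and> x13 = 1 \<and> x14 = 0 \<and> x15 = 0 \<and> x23 = 0 \<and> x24 = 0 \<and> x25 = 1 \<and> x34 = 1 \<and> x35 = 0 \<and> x45 = 1) \<or>
    (x12 = 0 \<and> x13 = 1 \<and> x14 = 0 \<and> x15 = 1 \<and> x23 = 1 \<and> x24 = 1 \<and> x25 = 0 \<and> x34 = 0 \<and> x35 = 0 \<and> x45 = 1) \<or>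
    (x12 = 0 \<and> x13 = 1 \<and> x14 = 1 \<and> x15 = 0 \<and> x23 = 1 \<and> x24 = 0 \<and> x25 = 1 \<and> x34 = 0 \<and> x35 = 0 \<and> x45 = 1) \<or>
    (x12 = 0 \<and> x13 = 1 \<and> x14 = 0 \<and> x15 = 1 \<and> x23 = 0 \<and> x24 = 1 \<and> x25 = 1 \<and> x34 = 1 \<and> x35 = 0 \<and> x45 = 0) \<or>
    (x12 = 0 \<and> x13 = 1 \<and> x14 = 1 \<and> x15 = 0 \<and> x23 = 0 \<and> x24 = 1 \<and> x25 = 1 \<and> x34 = 0 \<and> x35 = 1 \<and> x45 = 0) \<or>
    (x12 = 0 \<and> x13 = 0 \<and> x14 = 1 \<and> x15 = 1 \<and> x23 = 1 \<and> x24 = 1 \<and> x25 = 0 \<and> x34 = 0 \<and> x35 = 1 \<and> x45 = 0) \<or>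
    (x12 = 0 \<and> x13 = 0 \<and> x14 = 1 \<and> x15 = 1 \<and> x23 = 1 \<and> x24 = 0 \<and> x25 = 1 \<and> x34 = 1 \<and> x35 = 0 \<and> x45 = 0) \<or>
    (x12 = 1 \<and> x13 = 1 \<and> x14 = 0 \<and> x15 = 0 \<and> x23 = 1 \<and> x24 = 0 \<and> x25 = 0 \<and> x34 = 0 \<and> x35 = 0 \<and> x45 = 2) \<or>
    (x12 = 1 \<and> x13 = 0 \<and> x14 = 1 \<and> x15 = 0 \<and> x23 = 0 \<and> x24 = 1 \<and> x25 = 0 \<and> x34 = 0 \<and> x35 = 2 \<and> x45 = 0) \<or>
    (x12 = 1 \<and> x13 = 0 \<and> x14 = 0 \<and> x15 = 1 \<and> x23 = 0 \<and> x24 = 0 \<and> x25 = 1 \<and> x34 = 2 \<and> x35 = 0 \<and> x45 = 0) \<or>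
    (x12 = 0 \<and> x13 = 1 \<and> x14 = 1 \<and> x15 = 0 \<and> x23 = 0 \<and> x24 = 0 \<and> x25 = 2 \<and> x34 = 1 \<and> x35 = 0 \<and> x45 = 0) \<or>
    (x12 = 0 \<and> x13 = 1 \<and> x14 = 0 \<and> x15 = 1 \<and> x23 = 0 \<and> x24 = 2 \<and> x25 = 0 \<and> x34 = 0 \<and> x35 = 1 \<and> x45 = 0) \<or>
    (x12 = 0 \<and> x13 = 0 \<and> x14 = 1 \<and> x15 = 1 \<and> x23 = 2 \<and> x24 = 0 \<and> x25 = 0 \<and> x34 = 0 \<and> x35 = 0 \<and> x45 = 1) \<or>
    (x12 = 0 \<and> x13 = 0 \<and> x14 = 0 \<and> x15 = 2 \<and> x23 = 1 \<and> x24 = 1 \<and> x25 = 0 \<and> x34 = 1 \<and> x35 = 0 \<and> x45 = 0) \<or>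
    (x12 = 0 \<and> x13 = 0 \<and> x14 = 2 \<and> x15 = 0 \<and> x23 = 1 \<and> x24 = 0 \<and> x25 = 1 \<and> x34 = 0 \<and> x35 = 1 \<and> x45 = 0) \<or>
    (x12 = 0 \<and> x13 = 2 \<and> x14 = 0 \<and> x15 = 0 \<and> x23 = 0 \<and> x24 = 1 \<and> x25 = 1 \<and> x34 = 0 \<and> x35 = 0 \<and> x45 = 1) \<or>
    (x12 = 2 \<and> x13 = 0 \<and> x14 = 0 \<and> x15 = 0 \<and> x23 = 0 \<and> x24 = 0 \<and> x25 = 0 \<and> x34 = 1 \<and> x35 = 1 \<and> x45 = 1)"
proof -
  have r: "x12 \<in> set [0,1,2]" "x13 \<in> set [0,1,2]" "x14 \<in> set [0,1,2]" "x23 \<in> set [0,1,2]" "x24 \<in> set [0,1,2]" "x34 \<in> set [0,1,2]" using assms by simp_all linarith+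
  have e: "x15 = 2-x12-x13-x14" "x25 = 2-x12-x23-x24" "x35 = 2-x13-x23-x34" "x45 = 2-x14-x24-x34" using assms by linarith+
  have l: "x12 + x13 \<le> 2" "x12 + x13 + x14 \<le> 2" "x12 + x23 \<le> 2 \<and> x13 + x23 \<le> 2" "x12 + x23 + x24 \<le> 2 \<and> x14 + x24 \<le> 2"
    "x13 + x23 + x34 \<le> 2 \<and> x14 + x24 + x34 \<le> 2" "x15 + x25 + x35 + x45 = 2" using assms by linarith+
  show ?thesis unfolding e
    by (rule deg_cases_aux[rule_format, OF r(1) r(2) l(1) r(3) l(2) r(4) l(3) r(5) l(4) r(6) l(5) l(6)[unfolded e]])
qed

lemma P_sub: "P_monomials \<subseteq> pentagon_monomials \<union> triangle_monomials"
proof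
  fix m assume m: "m \<in> P_monomials"
  let ?c = "count m"
  have sub: "set_mset m \<subseteq> pairs" using m by (simp add: P_monomials_def)
  have fin: "finite pairs" by (simp add: pairs_eq)
  have deg: "(\<Sum>e\<in>pairs. if i \<in> e then ?c e else 0) = 2" if "i \<in> {1..5}" for i
    using m that size_filter_rep[OF sub fin, of "\<lambda>e. i \<in> e"] by (simp add: P_monomials_def)
  note d = deg[unfolded pairs_eq]
  have d1: "?c {1,2} + ?c {1,3} + ?c {1,4} + ?c {1,5} = 2" using d[of 1] by (simp add: doubleton_eq_iff)
  have d2: "?c {1,2} + ?c {2,3} + ?c {2,4} + ?c {2,5} = 2" using d[of 2] by (simp add: doubleton_eq_iff)
  have d3: "?c {1,3} + ?c {2,3} + ?c {3,4} + ?c {3,5} = 2" using d[of 3] by (simp add: doubleton_eq_iff)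
  have d4: "?c {1,4} + ?c {2,4} + ?c {3,4} + ?c {4,5} = 2" using d[of 4] by (simp add: doubleton_eq_iff)
  have d5: "?c {1,5} + ?c {2,5} + ?c {3,5} + ?c {4,5} = 2" using d[of 5] by (simp add: doubleton_eq_iff)
  have rep: "m = replicate_mset (?c {1,2}) {1,2} + replicate_mset (?c {1,3}) {1,3}
    + replicate_mset (?c {1,4}) {1,4} + replicate_mset (?c {1,5}) {1,5}
    + replicate_mset (?c {2,3}) {2,3} + replicate_mset (?c {2,4}) {2,4}
    + replicate_mset (?c {2,5}) {2,5} + replicate_mset (?c {3,4}) {3,4}
    + replicate_mset (?c {3,5}) {3,5} + replicate_mset (?c {4,5}) {4,5}"
    by (subst mset_rep[OF sub fin]) (simp add: pairs_eq doubleton_eq_iff add.assoc)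
  have r1: "replicate_mset 1 e = {#e#}" and r2: "replicate_mset 2 e = {#e, e#}" for e :: "nat set"
    by (simp_all add: numeral_2_eq_2)
  have v: "{1..5::nat} = {1,2,3,4,5}" by auto
  have pent: "{#{b1, b2}, {b2, b3}, {b3, b4}, {b4, b5}, {b5, b1}#} \<in> pentagon_monomials"
    if "distinct [b1, b2, b3, b4, b5]" "{b1, b2, b3, b4, b5} = {1,2,3,4,5}" for b1 b2 b3 b4 b5 :: nat
    unfolding pentagon_monomials_def v by (intro CollectI exI conjI, rule refl) (fact that)+
  have tri: "{#{a, b}, {b, c}, {c, a}, {d, e}, {d, e}#} \<in> triangle_monomials"
    if "distinct [a, b, c, d, e]" "{a, b, c, d, e} = {1,2,3,4,5}" for a b c d e :: nat
    unfolding triangle_monomials_def v by (intro CollectI exI conjI, rule refl) (fact that)+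
  show "m \<in> pentagon_monomials \<union> triangle_monomials"
    using deg_cases[OF d1 d2 d3 d4 d5]
  proof (elim disjE conjE, goal_cases)
    case c: 1
    have "m = {#{1,2}, {1,5}, {2,3}, {3,4}, {4,5}#}" by (subst rep, unfold c r1 r2 replicate_mset_0) (simp add: add_mset_commute)
    then show ?case using pent[of 1 2 3 4 5] by (simp add: ac_simps insert_commute add_mset_commute)
  next
    case c: 2
    have "m = {#{1,2}, {1,4}, {2,3}, {3,5}, {4,5}#}" by (subst rep, unfold c r1 r2 replicate_mset_0) (simp add: add_mset_commute)
    then show ?case using pent[of 1 2 3 5 4] by (simp add: ac_simps insert_commute add_mset_commute)
  next
    case c: 3
    have "m = {#{1,2}, {1,5}, {2,4}, {3,4}, {3,5}#}" by (subst rep, unfold c r1 r2 replicate_mset_0) (simp add: add_mset_commute)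
    then show ?case using pent[of 1 2 4 3 5] by (simp add: ac_simps insert_commute add_mset_commute)
  next
    case c: 4
    have "m = {#{1,2}, {1,3}, {2,4}, {3,5}, {4,5}#}" by (subst rep, unfold c r1 r2 replicate_mset_0) (simp add: add_mset_commute)
    then show ?case using pent[of 1 2 4 5 3] by (simp add: ac_simps insert_commute add_mset_commute)
  next
    case c: 5
    have "m = {#{1,2}, {1,4}, {2,5}, {3,4}, {3,5}#}" by (subst rep, unfold c r1 r2 replicate_mset_0) (simp add: add_mset_commute)
    then show ?case using pent[of 1 2 5 3 4] by (simp add: ac_simps insert_commute add_mset_commute)
  next
    case c: 6
    have "m = {#{1,2}, {1,3}, {2,5}, {3,4}, {4,5}#}" by (subst rep, unfold c r1 r2 replicate_mset_0) (simp add: add_mset_commute)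
    then show ?case using pent[of 1 2 5 4 3] by (simp add: ac_simps insert_commute add_mset_commute)
  next
    case c: 7
    have "m = {#{1,3}, {1,5}, {2,3}, {2,4}, {4,5}#}" by (subst rep, unfold c r1 r2 replicate_mset_0) (simp add: add_mset_commute)
    then show ?case using pent[of 1 3 2 4 5] by (simp add: ac_simps insert_commute add_mset_commute)
  next
    case c: 8
    have "m = {#{1,3}, {1,4}, {2,3}, {2,5}, {4,5}#}" by (subst rep, unfold c r1 r2 replicate_mset_0) (simp add: add_mset_commute)
    then show ?case using pent[of 1 3 2 5 4] by (simp add: ac_simps insert_commute add_mset_commute)
  next
    case c: 9
    have "m = {#{1,3}, {1,5}, {2,4}, {2,5}, {3,4}#}" by (subst rep, unfold c r1 r2 replicate_mset_0) (simp add: add_mset_commute)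
    then show ?case using pent[of 1 3 4 2 5] by (simp add: ac_simps insert_commute add_mset_commute)
  next
    case c: 10
    have "m = {#{1,3}, {1,4}, {2,4}, {2,5}, {3,5}#}" by (subst rep, unfold c r1 r2 replicate_mset_0) (simp add: add_mset_commute)
    then show ?case using pent[of 1 3 5 2 4] by (simp add: ac_simps insert_commute add_mset_commute)
  next
    case c: 11
    have "m = {#{1,4}, {1,5}, {2,3}, {2,4}, {3,5}#}" by (subst rep, unfold c r1 r2 replicate_mset_0) (simp add: add_mset_commute)
    then show ?case using pent[of 1 4 2 3 5] by (simp add: ac_simps insert_commute add_mset_commute)
  next
    case c: 12
    have "m = {#{1,4}, {1,5}, {2,3}, {2,5}, {3,4}#}" by (subst rep, unfold c r1 r2 replicate_mset_0) (simp add: add_mset_commute)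
    then show ?case using pent[of 1 4 3 2 5] by (simp add: ac_simps insert_commute add_mset_commute)
  next
    case c: 13
    have "m = {#{1,2}, {1,3}, {2,3}, {4,5}, {4,5}#}" by (subst rep, unfold c r1 r2 replicate_mset_0) (simp add: add_mset_commute)
    then show ?case using tri[of 1 2 3 4 5] by (simp add: ac_simps insert_commute add_mset_commute)
  next
    case c: 14
    have "m = {#{1,2}, {1,4}, {2,4}, {3,5}, {3,5}#}" by (subst rep, unfold c r1 r2 replicate_mset_0) (simp add: add_mset_commute)
    then show ?case using tri[of 1 2 4 3 5] by (simp add: ac_simps insert_commute add_mset_commute)
  next
    case c: 15
    have "m = {#{1,2}, {1,5}, {2,5}, {3,4}, {3,4}#}" by (subst rep, unfold c r1 r2 replicate_mset_0) (simp add: add_mset_commute)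
    then show ?case using tri[of 1 2 5 3 4] by (simp add: ac_simps insert_commute add_mset_commute)
  next
    case c: 16
    have "m = {#{1,3}, {1,4}, {2,5}, {2,5}, {3,4}#}" by (subst rep, unfold c r1 r2 replicate_mset_0) (simp add: add_mset_commute)
    then show ?case using tri[of 1 3 4 2 5] by (simp add: ac_simps insert_commute add_mset_commute)
  next
    case c: 17
    have "m = {#{1,3}, {1,5}, {2,4}, {2,4}, {3,5}#}" by (subst rep, unfold c r1 r2 replicate_mset_0) (simp add: add_mset_commute)
    then show ?case using tri[of 1 3 5 2 4] by (simp add: ac_simps insert_commute add_mset_commute)
  next
    case c: 18
    have "m = {#{1,4}, {1,5}, {2,3}, {2,3}, {4,5}#}" by (subst rep, unfold c r1 r2 replicate_mset_0) (simp add: add_mset_commute)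
    then show ?case using tri[of 1 4 5 2 3] by (simp add: ac_simps insert_commute add_mset_commute)
  next
    case c: 19
    have "m = {#{1,5}, {1,5}, {2,3}, {2,4}, {3,4}#}" by (subst rep, unfold c r1 r2 replicate_mset_0) (simp add: add_mset_commute)
    then show ?case using tri[of 2 3 4 1 5] by (simp add: ac_simps insert_commute add_mset_commute)
  next
    case c: 20
    have "m = {#{1,4}, {1,4}, {2,3}, {2,5}, {3,5}#}" by (subst rep, unfold c r1 r2 replicate_mset_0) (simp add: add_mset_commute)
    then show ?case using tri[of 2 3 5 1 4] by (simp add: ac_simps insert_commute add_mset_commute)
  next
    case c: 21
    have "m = {#{1,3}, {1,3}, {2,4}, {2,5}, {4,5}#}" by (subst rep, unfold c r1 r2 replicate_mset_0) (simp add: add_mset_commute)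
    then show ?case using tri[of 2 4 5 1 3] by (simp add: ac_simps insert_commute add_mset_commute)
  next
    case c: 22
    have "m = {#{1,2}, {1,2}, {3,4}, {3,5}, {4,5}#}" by (subst rep, unfold c r1 r2 replicate_mset_0) (simp add: add_mset_commute)
    then show ?case using tri[of 3 4 5 1 2] by (simp add: ac_simps insert_commute add_mset_commute)
  qed
qed

theorem P_monomials_eq: "P_monomials = pentagon_monomials \<union> triangle_monomials"
  using P_sub pent_tri_sub by blast

lemma finite_P_monomials: "finite P_monomials"
proof -
  have "P_monomials \<subseteq> mset ` {xs. set xs \<subseteq> pairs \<and> length xs = 5}"
  proof
    fix m assume m: "m \<in> P_monomials"
    obtain xs where "m = mset xs" by (metis ex_mset)
    then show "m \<in> mset ` {xs. set xs \<subseteq> pairs \<and> length xs = 5}"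
      using m by (auto simp: P_monomials_def)
  qed
  moreover have "finite {xs. set xs \<subseteq> pairs \<and> length xs = 5}"
    by (rule finite_lists_length_eq) (simp add: pairs_eq)
  ultimately show ?thesis by (meson finite_surj)
qed


end

theory Submission
  imports Defs
begin

text \<open>
  If \<open>M = min T\<^sub>1 T\<^sub>2\<close> for tree matrices, colouring each pair by a tree that attains it
  properly colours the deficiency graph. If some pentagon is strictly below all triangles, then its
  five pairs of disjoint edges are all edges of the deficiency graph and form a 5-cycle there.
  Finally, let the triangle \<open>abc\<close> with doubled edge \<open>de\<close> be minimal. Then \<open>M\<close> is the minimum of the
  tree matrix which agrees with \<open>M\<close> on all pairs meeting \<open>{d, e}\<close> and has the value
  \<open>min (M\<^sub>d\<^sub>i + M\<^sub>e\<^sub>j) (M\<^sub>d\<^sub>j + M\<^sub>e\<^sub>i) - M\<^sub>d\<^sub>e\<close> at \<open>{i, j}\<close> inside the triangle, and a star tree matrix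
  \<open>w\<^sub>i + w\<^sub>j\<close> which agrees with \<open>M\<close> on the triangle and is large elsewhere.
\<close>

text \<open>No \<open>min\<close> occurs on the right, so linear arithmetic can use the condition
  directly.\<close>

lemma min_attained_twice_iff:
  "min_attained_twice a b c \<longleftrightarrow> \<not> (a < b \<and> a < c) \<and> \<not> (b < a \<and> b < c) \<and> \<not> (c < a \<and> c < b)"
  by (auto simp: min_attained_twice_def Let_def min_def)

section \<open>Tree rank at most two\<close>

lemma min_of_trees_2_iff:
  "min_of_trees M 2 \<longleftrightarrow>
     (\<exists>T U. tree_matrix T \<and> tree_matrix U \<and> (\<forall>e\<in>pairs. M e = min (T e) (U e)))"
proof -
  have two: "{..<2::nat} = {0, 1}" by auto
  show ?thesis
  proof
    assume "min_of_trees M 2"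
    then obtain S :: "nat \<Rightarrow> dissim" where "\<forall>s<2. tree_matrix (S s)" "\<forall>e\<in>pairs. M e = Min ((\<lambda>s. S s e) ` {..<2})"
      by (auto simp: min_of_trees_def)
    then show "\<exists>T U. tree_matrix T \<and> tree_matrix U \<and> (\<forall>e\<in>pairs. M e = min (T e) (U e))"
      by (intro exI[of _ "S 0"] exI[of _ "S 1"]) (simp add: two)
  next
    assume "\<exists>T U. tree_matrix T \<and> tree_matrix U \<and> (\<forall>e\<in>pairs. M e = min (T e) (U e))"
    then obtain T U where "tree_matrix T" "tree_matrix U" "\<forall>e\<in>pairs. M e = min (T e) (U e)"
      by blast
    then show "min_of_trees M 2"
      unfolding min_of_trees_def
      by (intro conjI exI[of _ "\<lambda>s. if s = 0 then T else U"]) (simp_all add: two)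
  qed
qed

lemma tree_rank_le_2_iff: "tree_rank M \<le> 2 \<longleftrightarrow> min_of_trees M 2"
proof
  assume le: "tree_rank M \<le> 2"
  \<comment> \<open>Otherwise 3 bounds all candidates from below, hence also their infimum; this
    covers an empty set of candidates, whose infimum is infinite.\<close>
  have "\<exists>r. min_of_trees M r \<and> r \<le> 2"
  proof (rule ccontr)
    assume "\<nexists>r. min_of_trees M r \<and> r \<le> 2"
    then have "enat 3 \<le> enat r" if "min_of_trees M r" for r
      using that by (metis enat_ord_simps(1) not_less_eq_eq numeral_2_eq_2 numeral_3_eq_3)
    then have "enat 3 \<le> tree_rank M" unfolding tree_rank_def by (auto intro: INF_greatest)
    then have "enat 3 \<le> 2" using le by (rule order_trans)
    then show False by (simp add: numeral_eq_enat)
  qed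
  then obtain r where r: "min_of_trees M r" "r \<le> 2" by blast
  then have "r = 1 \<or> r = 2" by (auto simp: min_of_trees_def)
  then show "min_of_trees M 2"
  proof
    assume "r = 1"
    with r obtain S :: "nat \<Rightarrow> dissim"
      where "\<forall>s<1. tree_matrix (S s)" "\<forall>e\<in>pairs. M e = Min ((\<lambda>s. S s e) ` {..<1})"
      unfolding min_of_trees_def by blast
    moreover have "{..<1::nat} = {0}" by auto
    \<comment> \<open>The single tree matrix is used twice.\<close>
    ultimately show ?thesis unfolding min_of_trees_2_iff by (intro exI[of _ "S 0"]) simp
  qed (use r in simp)
next
  assume "min_of_trees M 2"
  then have "tree_rank M \<le> enat 2" unfolding tree_rank_def by (intro INF_lower) simp
  then show "tree_rank M \<le> 2" by (simp add: numeral_eq_enat)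
qed

section \<open>From two trees to a colouring\<close>

lemma doubleton_in_pairs: "x \<in> {1..5} \<Longrightarrow> y \<in> {1..5} \<Longrightarrow> x \<noteq> y \<Longrightarrow> {x, y} \<in> pairs"
  by (simp add: pairs_def)

text \<open>Agreement with \<open>M\<close> on \<open>u\<close> and \<open>v\<close>, and
  \<open>M \<le> T\<close> on the other four pairs, would make the strictly smallest of the three
  sums for \<open>M\<close> strictly smallest for \<open>T\<close> too.\<close>

lemma deficient_pair_not_in_same_tree:
  assumes "{u, v} \<in> deficiency_edges M" and T: "tree_matrix T" and le: "\<forall>e\<in>pairs. M e \<le> T e"
    and eq: "T u = M u" "T v = M v"
  shows False
proof -
  obtain i j k l where uv: "{u, v} = {{i, j}, {k, l}}"
    and h: "{i, j, k, l} \<subseteq> {1..5}" "distinct [i, j, k, l]"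
      "M {i, j} + M {k, l} < M {i, k} + M {j, l}" "M {i, j} + M {k, l} < M {i, l} + M {j, k}"
    using assms(1) unfolding deficiency_edges_def mem_Collect_eq by (elim exE conjE)
  have "T {i, j} = M {i, j}" "T {k, l} = M {k, l}"
    using uv eq by (metis insertCI insertE singletonD)+
  moreover have "M {i, k} \<le> T {i, k}" "M {j, l} \<le> T {j, l}" "M {i, l} \<le> T {i, l}" "M {j, k} \<le> T {j, k}"
    using h(1,2) le doubleton_in_pairs by auto
  moreover have "min_attained_twice (T {i, j} + T {k, l}) (T {i, k} + T {j, l}) (T {i, l} + T {j, k})"
    using T h(1,2) unfolding tree_matrix_def by blast
  ultimately show False using h(3,4) unfolding min_attained_twice_iff by linarith
qed

lemma colorable_if_min_of_trees_2:
  assumes "min_of_trees M 2"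
  shows "colorable 2 pairs (deficiency_edges M)"
proof -
  obtain T U where T: "tree_matrix T" and U: "tree_matrix U" and M: "\<forall>e\<in>pairs. M e = min (T e) (U e)"
    using assms unfolding min_of_trees_2_iff by blast
  have le: "\<forall>e\<in>pairs. M e \<le> T e" "\<forall>e\<in>pairs. M e \<le> U e" using M by auto
  \<comment> \<open>Ties get colour 0; on \<open>pairs\<close>, colour 1 forces
    \<open>U e = M e\<close>.\<close>
  define c where "c e = (if T e = M e then 0 else 1 :: nat)" for e
  show ?thesis
    unfolding colorable_def
  proof (intro exI[of _ c] conjI ballI impI notI)
    fix u v assume uv: "u \<in> pairs" "v \<in> pairs" "{u, v} \<in> deficiency_edges M" "c u = c v"
    have "T u = M u \<and> T v = M v \<or> U u = M u \<and> U v = M v"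
      using uv(4) M[rule_format, OF uv(1)] M[rule_format, OF uv(2)]
      unfolding c_def min_def by (metis zero_neq_one)
    then show False
      using deficient_pair_not_in_same_tree[OF uv(3)] T U le by blast
  qed (simp add: c_def)
qed

section \<open>From a colouring to a minimal triangle\<close>

lemma eval_pentagon:
  "eval_monomial M {#{b1, b2}, {b2, b3}, {b3, b4}, {b4, b5}, {b5, b1}#} =
     M {b1, b2} + M {b2, b3} + M {b3, b4} + M {b4, b5} + M {b5, b1}"
  by (simp add: eval_monomial_def)

lemma eval_triangle:
  "eval_monomial M {#{a, b}, {b, c}, {c, a}, {d, e}, {d, e}#} =
     M {a, b} + M {b, c} + M {c, a} + 2 * M {d, e}"
  by (simp add: eval_monomial_def)

text \<open>After cancellation, the triangle \<open>b1 b4 b5\<close> alone gives one of the two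
  strict inequalities; the other comes from adding those for the triangles \<open>b1 b2 b3\<close>
  and \<open>b2 b3 b4\<close>.\<close>

lemma deficient_if_pentagon_below_triangles:
  assumes d: "distinct [b1, b2, b3, b4, b5]" and v: "{b1, b2, b3, b4, b5} = {1..5}"
    and below: "\<And>t. t \<in> triangle_monomials \<Longrightarrow>
      M {b1, b2} + M {b2, b3} + M {b3, b4} + M {b4, b5} + M {b5, b1} < eval_monomial M t"
  shows "{{b1, b2}, {b3, b4}} \<in> deficiency_edges M"
proof -
  let ?P = "M {b1, b2} + M {b2, b3} + M {b3, b4} + M {b4, b5} + M {b5, b1}"
  have tri: "?P < M {p, q} + M {q, r} + M {r, p} + 2 * M {s, t}"
    if "distinct [p, q, r, s, t]" "{p, q, r, s, t} = {b1, b2, b3, b4, b5}" for p q r s t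
  proof -
    have "{#{p, q}, {q, r}, {r, p}, {s, t}, {s, t}#} \<in> triangle_monomials"
      unfolding triangle_monomials_def v[symmetric]
      by (intro CollectI exI conjI, rule refl) (fact that)+
    from below[OF this] show ?thesis unfolding eval_triangle .
  qed
  have t1: "?P < M {b1, b4} + M {b4, b5} + M {b5, b1} + 2 * M {b2, b3}"
    by (rule tri) (use d in auto)
  have t2: "?P < M {b1, b2} + M {b2, b3} + M {b3, b1} + 2 * M {b4, b5}"
    by (rule tri) (use d in auto)
  have t3: "?P < M {b2, b3} + M {b3, b4} + M {b4, b2} + 2 * M {b5, b1}"
    by (rule tri) (use d in auto)
  have "M {b1, b2} + M {b3, b4} < M {b1, b4} + M {b2, b3}" using t1 by linarith
  moreover have "M {b1, b2} + M {b3, b4} < M {b1, b3} + M {b2, b4}"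
    using t2 t3 by (simp add: insert_commute)
  moreover have "{b1, b2, b3, b4} \<subseteq> {1..5}" "distinct [b1, b2, b3, b4]" using d v by auto
  ultimately show ?thesis unfolding deficiency_edges_def by blast
qed

lemma triangle_attains_trop_P_if_colorable:
  assumes "colorable 2 pairs (deficiency_edges M)"
  shows "\<exists>t\<in>triangle_monomials. eval_monomial M t = trop_P M"
proof (rule ccontr)
  assume none: "\<not> ?thesis"
  have fin: "finite (eval_monomial M ` P_monomials)" by (simp add: finite_P_monomials)
  have "trop_P M \<in> eval_monomial M ` P_monomials"
    unfolding trop_P_def
  proof (rule Min_in[OF fin])
    have "distinct [1, 2, 3, 4, 5 :: nat]" "{1, 2, 3, 4, 5 :: nat} = {1..5}" by auto
    from pentagon_in_P[OF this] show "eval_monomial M ` P_monomials \<noteq> {}" by blast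
  qed
  then obtain m where "m \<in> P_monomials" and m: "trop_P M = eval_monomial M m" by blast
  with none have "m \<in> pentagon_monomials" by (auto simp: P_monomials_eq)
  then obtain b1 b2 b3 b4 b5 where d: "distinct [b1, b2, b3, b4, b5]"
    and v: "{b1, b2, b3, b4, b5} = {1..5}"
    and b: "m = {#{b1, b2}, {b2, b3}, {b3, b4}, {b4, b5}, {b5, b1}#}"
    unfolding pentagon_monomials_def by blast
  have below: "M {b1, b2} + M {b2, b3} + M {b3, b4} + M {b4, b5} + M {b5, b1} < eval_monomial M t"
    if "t \<in> triangle_monomials" for t
  proof -
    have "trop_P M \<le> eval_monomial M t"
      unfolding trop_P_def using that fin by (intro Min_le) (auto simp: P_monomials_eq)
    moreover have "eval_monomial M t \<noteq> trop_P M" using none that by blast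
    ultimately show ?thesis using m unfolding b eval_pentagon by linarith
  qed
  \<comment> \<open>This predicate is invariant under rotation, so one edge of the deficiency graph
    yields all five.\<close>
  define pent where "pent p q r s u \<longleftrightarrow>
      distinct [p, q, r, s, u] \<and> {p, q, r, s, u} = {1..5} \<and>
      (\<forall>t\<in>triangle_monomials. M {p, q} + M {q, r} + M {r, s} + M {s, u} + M {u, p} < eval_monomial M t)"
    for p q r s u
  have pent: "pent b1 b2 b3 b4 b5" using d v below by (simp add: pent_def)
  have rot: "pent q r s u p" if "pent p q r s u" for p q r s u
    using that unfolding pent_def by (simp add: insert_commute add_ac) blast
  have edge: "{{p, q}, {r, s}} \<in> deficiency_edges M" if "pent p q r s u" for p q r s u
    using that unfolding pent_def by (intro deficient_if_pentagon_below_triangles) blast+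
  have edges: "{{b1, b2}, {b3, b4}} \<in> deficiency_edges M" "{{b3, b4}, {b5, b1}} \<in> deficiency_edges M"
    "{{b5, b1}, {b2, b3}} \<in> deficiency_edges M" "{{b2, b3}, {b4, b5}} \<in> deficiency_edges M"
    "{{b4, b5}, {b1, b2}} \<in> deficiency_edges M"
    by (rule edge, blast intro: pent rot)+
  have mem: "{b1, b2} \<in> pairs" "{b2, b3} \<in> pairs" "{b3, b4} \<in> pairs" "{b4, b5} \<in> pairs" "{b5, b1} \<in> pairs"
    using d v by (auto intro!: doubleton_in_pairs)
  obtain c :: "nat set \<Rightarrow> nat" where c: "\<And>u. u \<in> pairs \<Longrightarrow> c u < 2"
    and c': "\<And>u v. u \<in> pairs \<Longrightarrow> v \<in> pairs \<Longrightarrow> {u, v} \<in> deficiency_edges M \<Longrightarrow> c u \<noteq> c v"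
    using assms unfolding colorable_def by blast
  \<comment> \<open>Two colours would have to alternate around a cycle of odd length.\<close>
  show False
    using c'[OF mem(1,3) edges(1)] c'[OF mem(3,5) edges(2)] c'[OF mem(5,2) edges(3)]
      c'[OF mem(2,4) edges(4)] c'[OF mem(4,1) edges(5)] c[OF mem(1)] c[OF mem(2)] c[OF mem(3)]
      c[OF mem(4)] c[OF mem(5)]
    by linarith
qed

section \<open>From a minimal triangle to two trees\<close>

lemma tree_matrix_star: "tree_matrix (\<lambda>e. \<Sum>x\<in>e. w x)"
  \<comment> \<open>All three sums equal \<open>w i + w j + w k + w l\<close>.\<close>
  unfolding tree_matrix_def by (auto simp: min_attained_twice_iff)

text \<open>
  Such a \<open>T\<close> is, up to the constant \<open>T\<^sub>d\<^sub>e\<close>, the vector of tropical 2 by 2 minors of the matrix with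
  rows \<open>T\<^sub>d\<close> and \<open>T\<^sub>e\<close>, and so satisfies the tropical Pluecker relations.
\<close>

lemma tree_matrix_of_two_rows:
  fixes T :: dissim
  assumes d: "distinct [a, b, c, d, e]" and v: "{a, b, c, d, e} = {1..5}"
    and ab: "T {a, b} = min (T {d, a} + T {e, b}) (T {d, b} + T {e, a}) - T {d, e}"
    and bc: "T {b, c} = min (T {d, b} + T {e, c}) (T {d, c} + T {e, b}) - T {d, e}"
    and ca: "T {c, a} = min (T {d, c} + T {e, a}) (T {d, a} + T {e, c}) - T {d, e}"
  shows "tree_matrix T"
proof -
  define Q where
    "Q i j k l = min_attained_twice (T {i, j} + T {k, l}) (T {i, k} + T {j, l}) (T {i, l} + T {j, k})"
    for i j k l
  \<comment> \<open>Adjacent transpositions generate all orders of four indices, so one order for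
    each of the five 4-subsets suffices.\<close>
  have swap: "Q i j k l = Q j i k l" "Q i j k l = Q i k j l" "Q i j k l = Q i j l k" for i j k l
    unfolding Q_def min_attained_twice_iff by (auto simp: insert_commute add.commute)
  have Q: "Q a b d e" "Q b c d e" "Q c a d e" "Q a b c d" "Q a b c e"
    unfolding Q_def min_attained_twice_iff using ab bc ca
    by (auto simp: insert_commute min_def)
  have "Q i j k l" if ijkl: "{i, j, k, l} \<subseteq> {1..5}" "distinct [i, j, k, l]" for i j k l
  proof -
    have mem: "i \<in> {a, b, c, d, e}" "j \<in> {a, b, c, d, e}" "k \<in> {a, b, c, d, e}" "l \<in> {a, b, c, d, e}"
      using ijkl(1) unfolding v by auto
    show ?thesis using mem ijkl(2) Q
      by (elim insertE emptyE) (simp_all, (metis swap)+)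
  qed
  then show ?thesis unfolding tree_matrix_def Q_def by blast
qed

lemma min_of_trees_2_if_triangle_attains_trop_P:
  assumes "t \<in> triangle_monomials" and t: "eval_monomial M t = trop_P M"
  shows "min_of_trees M 2"
proof -
  obtain a b c d e where dist: "distinct [a, b, c, d, e]" and v: "{a, b, c, d, e} = {1..5}"
    and t_eq: "t = {#{a, b}, {b, c}, {c, a}, {d, e}, {d, e}#}"
    using assms(1) unfolding triangle_monomials_def by blast
  have pent: "M {a, b} + M {b, c} + M {c, a} + 2 * M {d, e} \<le>
      M {p, q} + M {q, r} + M {r, s} + M {s, u} + M {u, p}"
    if "distinct [p, q, r, s, u]" "{p, q, r, s, u} = {a, b, c, d, e}" for p q r s u
  proof -
    have "{#{p, q}, {q, r}, {r, s}, {s, u}, {u, p}#} \<in> P_monomials"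
      using pentagon_in_P that v by simp
    then have "trop_P M \<le> eval_monomial M {#{p, q}, {q, r}, {r, s}, {s, u}, {u, p}#}"
      unfolding trop_P_def using finite_P_monomials by simp
    then show ?thesis using t unfolding t_eq eval_triangle eval_pentagon by simp
  qed
  define T where "T x =
    (if x = {a, b} then min (M {d, a} + M {e, b}) (M {d, b} + M {e, a}) - M {d, e}
     else if x = {b, c} then min (M {d, b} + M {e, c}) (M {d, c} + M {e, b}) - M {d, e}
     else if x = {c, a} then min (M {d, c} + M {e, a}) (M {d, a} + M {e, c}) - M {d, e}
     else M x)" for x
  have T_simps: "T {a, b} = min (M {d, a} + M {e, b}) (M {d, b} + M {e, a}) - M {d, e}"
    "T {b, c} = min (M {d, b} + M {e, c}) (M {d, c} + M {e, b}) - M {d, e}"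
    "T {c, a} = min (M {d, c} + M {e, a}) (M {d, a} + M {e, c}) - M {d, e}"
    "T {d, a} = M {d, a}" "T {d, b} = M {d, b}" "T {d, c} = M {d, c}"
    "T {e, a} = M {e, a}" "T {e, b} = M {e, b}" "T {e, c} = M {e, c}" "T {d, e} = M {d, e}"
    using dist unfolding T_def by (auto simp: doubleton_eq_iff)
  have T: "tree_matrix T"
    by (rule tree_matrix_of_two_rows[OF dist v]) (simp_all add: T_simps)
  have T_ge: "M {a, b} \<le> T {a, b}" "M {b, c} \<le> T {b, c}" "M {c, a} \<le> T {c, a}"
  proof -
    \<comment> \<open>Cancelling the shared terms leaves
      \<open>M {i, j} + M {d, e} \<le> M {d, i} + M {e, j}\<close>; the six orders of
      \<open>a, b, c\<close> give both bounds for each of the three minima.\<close>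
    have "M {a, b} + M {b, c} + M {c, a} + 2 * M {d, e} \<le>
        M {d, i} + M {i, k} + M {k, j} + M {j, e} + M {e, d}"
      if "distinct [i, j, k]" "{i, j, k} = {a, b, c}" for i j k
      by (rule pent) (use that dist in auto)
    from this[of a b c] this[of b a c] this[of b c a] this[of c b a] this[of c a b] this[of a c b]
    show "M {a, b} \<le> T {a, b}" "M {b, c} \<le> T {b, c}" "M {c, a} \<le> T {c, a}"
      unfolding T_simps using dist by (auto simp: insert_commute)
  qed
  txt \<open>The weights at \<open>a, b, c\<close> solve \<open>w\<^sub>i + w\<^sub>j = M\<^sub>i\<^sub>j\<close> on the triangle.\<close>
  define wa where "wa = (M {a, b} + M {c, a} - M {b, c}) / 2"
  define wb where "wb = (M {a, b} + M {b, c} - M {c, a}) / 2"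
  define wc where "wc = (M {b, c} + M {c, a} - M {a, b}) / 2"
  \<comment> \<open>The least common weight of \<open>d\<close> and \<open>e\<close> for which the
    star dominates \<open>M\<close> on all pairs meeting \<open>{d, e}\<close>; the pair
    \<open>{d, e}\<close> receives it twice, hence the half.\<close>
  define L where "L = Max {M {d, a} - wa, M {e, a} - wa, M {d, b} - wb, M {e, b} - wb,
    M {d, c} - wc, M {e, c} - wc, M {d, e} / 2}"
  have L: "M {d, a} - wa \<le> L" "M {e, a} - wa \<le> L" "M {d, b} - wb \<le> L" "M {e, b} - wb \<le> L"
    "M {d, c} - wc \<le> L" "M {e, c} - wc \<le> L" "M {d, e} / 2 \<le> L"
    unfolding L_def by (rule Max_ge; simp)+
  define w where "w x = (if x = a then wa else if x = b then wb else if x = c then wc else L)" for x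
  define U where "U x = (\<Sum>i\<in>x. w i)" for x
  have U_simps: "U {a, b} = M {a, b}" "U {b, c} = M {b, c}" "U {c, a} = M {c, a}"
    "U {d, a} = L + wa" "U {d, b} = L + wb" "U {d, c} = L + wc"
    "U {e, a} = L + wa" "U {e, b} = L + wb" "U {e, c} = L + wc" "U {d, e} = 2 * L"
    using dist unfolding U_def w_def by (auto simp: wa_def wb_def wc_def field_simps)
  have U: "tree_matrix U" unfolding U_def by (rule tree_matrix_star)
  have "M x = min (T x) (U x)" if x_pair: "x \<in> pairs" for x
  proof -
    obtain p q where x: "x = {p, q}" "p \<noteq> q" and "p \<in> {1..5}" "q \<in> {1..5}"
      using x_pair unfolding pairs_def card_2_iff by blast
    then have "p \<in> {a, b, c, d, e}" "q \<in> {a, b, c, d, e}" unfolding v by simp_all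
    with x have "x \<in> {{a, b}, {b, c}, {c, a}, {d, a}, {d, b}, {d, c}, {e, a}, {e, b}, {e, c}, {d, e}}"
      by (elim insertE emptyE) (simp_all add: insert_commute)
    then show ?thesis
      \<comment> \<open>On the triangle \<open>U\<close> attains the minimum and \<open>T_ge\<close>
        suffices, so the formulas for \<open>T\<close> there stay folded; elsewhere \<open>T\<close>
        attains it and \<open>L\<close> bounds \<open>U\<close> from below.\<close>
      using T_ge L by (elim insertE emptyE) (simp_all only: T_simps(4-) U_simps min_def, auto)
  qed
  with T U show ?thesis unfolding min_of_trees_2_iff by blast
qed

theorem theorem8p1:
  fixes M :: "nat set \<Rightarrow> real"
  shows "(tree_rank M \<le> 2 \<longleftrightarrow> colorable 2 pairs (deficiency_edges M)) \<and>
         (colorable 2 pairs (deficiency_edges M) \<longleftrightarrow>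
            (\<exists>t\<in>triangle_monomials. eval_monomial M t = trop_P M))"
  using colorable_if_min_of_trees_2 triangle_attains_trop_P_if_colorable
    min_of_trees_2_if_triangle_attains_trop_P
  unfolding tree_rank_le_2_iff by blast

end
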